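(* Let $(A,[\cdot,\cdot]_1,\circ_1)$ be a Malcev-Poisson algebra and let $(A^*,[\cdot,\cdot]_2,\circ_2)$ be a Malcev-Poisson algebra structure on the dual space $A^*$. Then $(A\oplus A^*,A,A^* )$ is a standard Manin triple of Malcev-Poisson algebras if and only if $(A,A^*,\mathrm{ad}_A^*,-L^*,\mathrm{ad}_{A^*}^*,-\mathcal{L}_{A^*}^* )$ is a matched pair of Malcev-Poisson algebras.
   Context: All vector spaces are finite-dimensional over an algebraically closed field $\mathbb{K}$ of characteristic $0$. A Malcev algebra is a vector space with an antisymmetric bilinear bracket satisfying $J(x,y,[x,z])=[J(x,y,z),x]$, where $J(x,y,z)=[[x,y],z]+[[z,x],y]+[[y,z],x]$. A Malcev-Poisson algebra $(A,[\cdot,\cdot],\circ)$: a Malcev bracket and a commutative associative product $\circ$ with $[x,y\circ z]=[x,y]\circ z+y\circ[x,z]$. Representations: of a Malcev algebra, a linear $\varrho:A\to\mathrm{End}(V)$ with $\varrho([[x,y],z])=\varrho(z)\varrho(y)\varrho(x)-\varrho(y)\varrho(x)\varrho(z)+\varrho(x)\varrho([y,z])+\varrho([x,z])\varrho(y)$; of a commutative associative algebra, $\mu$ with $\mu(x\circ y)=\mu(x)\mu(y)$; of a Malcev-Poisson algebra, a pair $(\varrho,\mu)$ of these with $\varrho(x\circ y)=\mu(y)\varrho(x)+\mu(x)\varrho(y)$ and $\mu([x,y])=\varrho(x)\mu(y)-\mu(y)\varrho(x)$. Notation: for $\theta:A\to\mathrm{End}(V)$, $\theta^*:A\to\mathrm{End}(V^*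 )$ is $\langle\theta^*(x)\xi,v\rangle=-\langle\xi,\theta(x)v\rangle$. $\mathrm{ad}(x)y=[x,y]_1$, $L(x)y=x\circ_1y$ on $A$; $\mathrm{ad}_A^*=\mathrm{ad}^*$, $L^*$ are their duals (maps $A\to\mathrm{End}(A^* )$); similarly $\mathrm{ad}_{A^*}^*$, $\mathcal{L}_{A^*}^*:A^*\to\mathrm{End}(A)$ are the duals of $\xi\mapsto[\xi,\cdot]_2$, $\xi\mapsto\xi\circ_2\cdot$ (with $A^{**}=A$), i.e. $\langle \mathrm{ad}_{A^*}^*(\xi)x,\eta\rangle=-\langle x,[\xi,\eta]_2\rangle$, $\langle\mathcal{L}_{A^*}^*(\xi)x,\eta\rangle=-\langle x,\xi\circ_2\eta\rangle$. Matched pair of Malcev-Poisson algebras $(A_1,A_2,\varrho_1,\mu_1,\varrho_2,\mu_2)$ ($\varrho_1,\mu_1:A_1\to\mathrm{End}(A_2)$, $\varrho_2,\mu_2:A_2\to\mathrm{End}(A_1)$): (i) $\mu_1,\mu_2$ are associative representations with $\mu_1(x_1)(x_2\circ_2y_2)=(\mu_1(x_1)x_2)\circ_2y_2+\mu_1(\mu_2(x_2)x_1)y_2$ and $\mu_2(x_2)(x_1\circ_1y_1)=(\mu_2(x_2)x_1)\circ_1y_1+\mu_2(\mu_1(x_1)x_2)y_1$; (ii) $\varrho_1,\varrho_2$ are Malcev representations such that the bracket $[x_1+x_2,y_1+y_2]=[x_1,y_1]_1+\varrho_2(x_2)y_1-\varrho_2(y_2)x_1+[x_2,y_2]_2+\varrho_1(x_1)y_2-\varrho_1(y_1)x_2$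 on $A_1\oplus A_2$ is a Malcev bracket (matched pair of Malcev algebras); (iii) $(A_2,\varrho_1,\mu_1)$, $(A_1,\varrho_2,\mu_2)$ are Malcev-Poisson representations; (iv) for all $x_i,y_i\in A_i$: $\varrho_2(x_2)(x_1\circ_1y_1)=(\varrho_2(x_2)x_1)\circ_1y_1+x_1\circ_1(\varrho_2(x_2)y_1)-\mu_2(\varrho_1(x_1)x_2)y_1-\mu_2(\varrho_1(y_1)x_2)x_1$; $\varrho_1(x_1)(x_2\circ_2y_2)=(\varrho_1(x_1)x_2)\circ_2y_2+x_2\circ_2(\varrho_1(x_1)y_2)-\mu_1(\varrho_2(x_2)x_1)y_2-\mu_1(\varrho_2(y_2)x_1)x_2$; $[x_1,\mu_2(x_2)y_1]_1-\varrho_2(\mu_1(y_1)x_2)x_1=\mu_2(\varrho_1(x_1)x_2)y_1-(\varrho_2(x_2)x_1)\circ_1y_1+\mu_2(x_2)[x_1,y_1]_1$; $[x_2,\mu_1(x_1)y_2]_2-\varrho_1(\mu_2(y_2)x_1)x_2=\mu_1(\varrho_2(x_2)x_1)y_2-(\varrho_1(x_1)x_2)\circ_2y_2+\mu_1(x_1)[x_2,y_2]_2$. A standard Manin triple of Malcev-Poisson algebras $(A\oplus A^*,A,A^* )$ means: a Malcev-Poisson algebra structure on $A\oplus A^*$ for which $(A,[\cdot,\cdot]_1,\circ_1)$ and $(A^*,[\cdot,\cdot]_2,\circ_2)$ are Malcev-Poisson subalgebras and the bilinear form $\omega_d(x+\xi,y+\eta)=\langle x,\eta\rangle+\langle\xi,y\rangle$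 is invariant: $\omega_d(u\circ v,w)=\omega_d(u,v\circ w)$ and $\omega_d([u,v],w)=\omega_d(u,[v,w])$ for all $u,v,w\in A\oplus A^*$. *)

theory Defs
  imports "HOL-Analysis.Finite_Cartesian_Product" "HOL-Library.Product_Plus"
    "HOL-Computational_Algebra.Polynomial"
begin

(* Ground field: algebraically closed (of characteristic 0 via the class field_char_0). *)
definition alg_closed_field :: "'k::field itself \<Rightarrow> bool" where
  "alg_closed_field _ \<longleftrightarrow> (\<forall>p::'k poly. degree p \<ge> 1 \<longrightarrow> (\<exists>x. poly p x = 0))"

(* linearity w.r.t. given scalar multiplications *)
definition lin :: "('k \<Rightarrow> 'a \<Rightarrow> 'a::plus) \<Rightarrow> ('k \<Rightarrow> 'b \<Rightarrow> 'b::plus) \<Rightarrow> ('a \<Rightarrow> 'b) \<Rightarrow> bool" where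
  "lin s t f \<longleftrightarrow> (\<forall>x y. f (x + y) = f x + f y) \<and> (\<forall>c x. f (s c x) = t c (f x))"

definition bilin :: "('k \<Rightarrow> 'a \<Rightarrow> 'a::plus) \<Rightarrow> ('a \<Rightarrow> 'a \<Rightarrow> 'a) \<Rightarrow> bool" where
  "bilin s B \<longleftrightarrow> (\<forall>x. lin s s (B x)) \<and> (\<forall>y. lin s s (\<lambda>x. B x y))"

definition jac :: "('a::ab_group_add \<Rightarrow> 'a \<Rightarrow> 'a) \<Rightarrow> 'a \<Rightarrow> 'a \<Rightarrow> 'a \<Rightarrow> 'a" where
  "jac br x y z = br (br x y) z + br (br z x) y + br (br y z) x"

(* antisymmetric bracket satisfying the Malcev identity *)
definition malcev :: "('a::ab_group_add \<Rightarrow> 'a \<Rightarrow> 'a) \<Rightarrow> bool" where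
  "malcev br \<longleftrightarrow> (\<forall>x y. br x y = - br y x) \<and>
     (\<forall>x y z. jac br x y (br x z) = br (jac br x y z) x)"

definition comm_assoc :: "('a \<Rightarrow> 'a \<Rightarrow> 'a) \<Rightarrow> bool" where
  "comm_assoc m \<longleftrightarrow> (\<forall>x y. m x y = m y x) \<and> (\<forall>x y z. m (m x y) z = m x (m y z))"

(* Malcev-Poisson algebra (bilinear operations) *)
definition malcev_poisson :: "('k \<Rightarrow> 'a \<Rightarrow> 'a) \<Rightarrow> ('a::ab_group_add \<Rightarrow> 'a \<Rightarrow> 'a) \<Rightarrow> ('a \<Rightarrow> 'a \<Rightarrow> 'a) \<Rightarrow> bool" where
  "malcev_poisson s br m \<longleftrightarrow> bilin s br \<and> bilin s m \<and> malcev br \<and> comm_assoc m \<and>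
     (\<forall>x y z. br x (m y z) = m (br x y) z + m y (br x z))"

(* a linear map A \<rightarrow> End(V) *)
definition rep_linear :: "('k \<Rightarrow> 'a \<Rightarrow> 'a::plus) \<Rightarrow> ('k \<Rightarrow> 'v \<Rightarrow> 'v::plus) \<Rightarrow> ('a \<Rightarrow> 'v \<Rightarrow> 'v) \<Rightarrow> bool" where
  "rep_linear sA sV r \<longleftrightarrow> (\<forall>x. lin sV sV (r x)) \<and> (\<forall>v. lin sA sV (\<lambda>x. r x v))"

definition malcev_rep :: "('k \<Rightarrow> 'a \<Rightarrow> 'a::plus) \<Rightarrow> ('k \<Rightarrow> 'v \<Rightarrow> 'v::ab_group_add) \<Rightarrow>
    ('a \<Rightarrow> 'a \<Rightarrow> 'a) \<Rightarrow> ('a \<Rightarrow> 'v \<Rightarrow> 'v) \<Rightarrow> bool" where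
  "malcev_rep sA sV br r \<longleftrightarrow> rep_linear sA sV r \<and>
     (\<forall>x y z v. r (br (br x y) z) v =
        r z (r y (r x v)) - r y (r x (r z v)) + r x (r (br y z) v) + r (br x z) (r y v))"

definition assoc_rep :: "('k \<Rightarrow> 'a \<Rightarrow> 'a::plus) \<Rightarrow> ('k \<Rightarrow> 'v \<Rightarrow> 'v::plus) \<Rightarrow>
    ('a \<Rightarrow> 'a \<Rightarrow> 'a) \<Rightarrow> ('a \<Rightarrow> 'v \<Rightarrow> 'v) \<Rightarrow> bool" where
  "assoc_rep sA sV m \<mu> \<longleftrightarrow> rep_linear sA sV \<mu> \<and> (\<forall>x y v. \<mu> (m x y) v = \<mu> x (\<mu> y v))"

definition mp_rep :: "('k \<Rightarrow> 'a \<Rightarrow> 'a::plus) \<Rightarrow> ('k \<Rightarrow> 'v \<Rightarrow> 'v::ab_group_add) \<Rightarrow>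
    ('a \<Rightarrow> 'a \<Rightarrow> 'a) \<Rightarrow> ('a \<Rightarrow> 'a \<Rightarrow> 'a) \<Rightarrow> ('a \<Rightarrow> 'v \<Rightarrow> 'v) \<Rightarrow> ('a \<Rightarrow> 'v \<Rightarrow> 'v) \<Rightarrow> bool" where
  "mp_rep sA sV br m r \<mu> \<longleftrightarrow> malcev_rep sA sV br r \<and> assoc_rep sA sV m \<mu> \<and>
     (\<forall>x y v. r (m x y) v = \<mu> y (r x v) + \<mu> x (r y v)) \<and>
     (\<forall>x y v. \<mu> (br x y) v = r x (\<mu> y v) - \<mu> y (r x v))"

(* the bracket on A1 \<oplus> A2 determined by a pair of representations *)
fun mp_bracket :: "('a::ab_group_add \<Rightarrow> 'a \<Rightarrow> 'a) \<Rightarrow> ('b::ab_group_add \<Rightarrow> 'b \<Rightarrow> 'b) \<Rightarrow>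
    ('a \<Rightarrow> 'b \<Rightarrow> 'b) \<Rightarrow> ('b \<Rightarrow> 'a \<Rightarrow> 'a) \<Rightarrow> 'a \<times> 'b \<Rightarrow> 'a \<times> 'b \<Rightarrow> 'a \<times> 'b" where
  "mp_bracket br1 br2 r1 r2 (x1, x2) (y1, y2) =
     (br1 x1 y1 + r2 x2 y1 - r2 y2 x1, br2 x2 y2 + r1 x1 y2 - r1 y1 x2)"

definition matched_pair :: "('k \<Rightarrow> 'a \<Rightarrow> 'a) \<Rightarrow> ('k \<Rightarrow> 'b \<Rightarrow> 'b) \<Rightarrow>
    ('a::ab_group_add \<Rightarrow> 'a \<Rightarrow> 'a) \<Rightarrow> ('a \<Rightarrow> 'a \<Rightarrow> 'a) \<Rightarrow>
    ('b::ab_group_add \<Rightarrow> 'b \<Rightarrow> 'b) \<Rightarrow> ('b \<Rightarrow> 'b \<Rightarrow> 'b) \<Rightarrow>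
    ('a \<Rightarrow> 'b \<Rightarrow> 'b) \<Rightarrow> ('a \<Rightarrow> 'b \<Rightarrow> 'b) \<Rightarrow> ('b \<Rightarrow> 'a \<Rightarrow> 'a) \<Rightarrow> ('b \<Rightarrow> 'a \<Rightarrow> 'a) \<Rightarrow> bool" where
  "matched_pair s1 s2 br1 m1 br2 m2 r1 \<mu>1 r2 \<mu>2 \<longleftrightarrow>
     \<comment> \<open>(i)\<close>
     assoc_rep s1 s2 m1 \<mu>1 \<and> assoc_rep s2 s1 m2 \<mu>2 \<and>
     (\<forall>x1 x2 y2. \<mu>1 x1 (m2 x2 y2) = m2 (\<mu>1 x1 x2) y2 + \<mu>1 (\<mu>2 x2 x1) y2) \<and>
     (\<forall>x2 x1 y1. \<mu>2 x2 (m1 x1 y1) = m1 (\<mu>2 x2 x1) y1 + \<mu>2 (\<mu>1 x1 x2) y1) \<and>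
     \<comment> \<open>(ii)\<close>
     malcev_rep s1 s2 br1 r1 \<and> malcev_rep s2 s1 br2 r2 \<and>
     malcev (mp_bracket br1 br2 r1 r2) \<and>
     \<comment> \<open>(iii)\<close>
     mp_rep s1 s2 br1 m1 r1 \<mu>1 \<and> mp_rep s2 s1 br2 m2 r2 \<mu>2 \<and>
     \<comment> \<open>(iv)\<close>
     (\<forall>x1 y1 x2. r2 x2 (m1 x1 y1) = m1 (r2 x2 x1) y1 + m1 x1 (r2 x2 y1)
          - \<mu>2 (r1 x1 x2) y1 - \<mu>2 (r1 y1 x2) x1) \<and>
     (\<forall>x2 y2 x1. r1 x1 (m2 x2 y2) = m2 (r1 x1 x2) y2 + m2 x2 (r1 x1 y2)
          - \<mu>1 (r2 x2 x1) y2 - \<mu>1 (r2 y2 x1) x2) \<and>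
     (\<forall>x1 y1 x2. br1 x1 (\<mu>2 x2 y1) - r2 (\<mu>1 y1 x2) x1
          = \<mu>2 (r1 x1 x2) y1 - m1 (r2 x2 x1) y1 + \<mu>2 x2 (br1 x1 y1)) \<and>
     (\<forall>x2 y2 x1. br2 x2 (\<mu>1 x1 y2) - r1 (\<mu>2 y2 x1) x2
          = \<mu>1 (r2 x2 x1) y2 - m2 (r1 x1 x2) y2 + \<mu>1 x1 (br2 x2 y2))"

(* Model: A = 'k^'n (a finite-dimensional space with a chosen basis) and A-dual = 'k^'n,
   with the canonical nondegenerate pairing <x, xi> = sum_i x_i xi_i. *)
definition dpair :: "'k::comm_ring ^ 'n::finite \<Rightarrow> 'k ^ 'n \<Rightarrow> 'k" where
  "dpair u v = (\<Sum>i\<in>UNIV. u $ i * v $ i)"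

(* dual representation theta-dual: <theta-dual(x) xi, v> = - <xi, theta(x) v> *)
definition dual_rep :: "('a \<Rightarrow> 'k::comm_ring ^ 'n::finite \<Rightarrow> 'k ^ 'n) \<Rightarrow> 'a \<Rightarrow> 'k ^ 'n \<Rightarrow> 'k ^ 'n" where
  "dual_rep \<theta> x \<xi> = (THE \<eta>. \<forall>v. dpair \<eta> v = - dpair \<xi> (\<theta> x v))"

(* scalar multiplication on A \<oplus> A-dual *)
definition dsc :: "'k::times \<Rightarrow> ('k ^ 'n) \<times> ('k ^ 'n) \<Rightarrow> ('k ^ 'n) \<times> ('k ^ 'n)" where
  "dsc c u = (c *s fst u, c *s snd u)"

(* the bilinear form omega_d on A \<oplus> A-dual *)
definition omega_d :: "('k::comm_ring ^ 'n::finite) \<times> ('k ^ 'n) \<Rightarrow> ('k ^ 'n) \<times> ('k ^ 'n) \<Rightarrow> 'k" where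
  "omega_d u w = dpair (fst u) (snd w) + dpair (snd u) (fst w)"

(* standard Manin triple (A \<oplus> A-dual, A, A-dual) of Malcev-Poisson algebras *)
definition std_manin_triple :: "('k::field ^ 'n::finite \<Rightarrow> 'k ^ 'n \<Rightarrow> 'k ^ 'n) \<Rightarrow> ('k ^ 'n \<Rightarrow> 'k ^ 'n \<Rightarrow> 'k ^ 'n) \<Rightarrow>
    ('k ^ 'n \<Rightarrow> 'k ^ 'n \<Rightarrow> 'k ^ 'n) \<Rightarrow> ('k ^ 'n \<Rightarrow> 'k ^ 'n \<Rightarrow> 'k ^ 'n) \<Rightarrow> bool" where
  "std_manin_triple br1 m1 br2 m2 \<longleftrightarrow>
     (\<exists>br m. malcev_poisson dsc br m \<and>
        (\<forall>x y. br (x, 0) (y, 0) = (br1 x y, 0)) \<and> (\<forall>x y. m (x, 0) (y, 0) = (m1 x y, 0)) \<and>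
        (\<forall>\<xi> \<eta>. br (0, \<xi>) (0, \<eta>) = (0, br2 \<xi> \<eta>)) \<and> (\<forall>\<xi> \<eta>. m (0, \<xi>) (0, \<eta>) = (0, m2 \<xi> \<eta>)) \<and>
        (\<forall>u v w. omega_d (m u v) w = omega_d u (m v w)) \<and>
        (\<forall>u v w. omega_d (br u v) w = omega_d u (br v w)))"

end

(*
  Invariance of omega_d makes omega_d (B u v) w cyclic in u, v, w, so a bracket or product on
  A + A^* that restricts to the given ones on A and on A^* is determined on mixed arguments: it
  can only be the bracket of the matched pair built from the coadjoint maps ad^* and -L^* of both
  sides, resp. the product (x + xi) o (y + eta) = x o y + mu2 xi y + mu2 eta x + xi o eta +
  mu1 x eta + mu1 y xi, and these are always invariant. So a standard Manin triple exists iff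
  this double is Malcev-Poisson. Evaluating its associativity and Leibniz defects on homogeneous
  triples gives exactly conditions (i), (iii) and (iv) of a matched pair, its Malcev identity is
  (ii), and the representation conditions follow from the Malcev identity because, without
  2-torsion, the adjoint action of a Malcev algebra is a representation.
*)
theory Submission
  imports Defs
begin

section \<open>Biadditive maps\<close>

locale biadditive =
  fixes f :: "'a::ab_group_add \<Rightarrow> 'b::ab_group_add \<Rightarrow> 'c::ab_group_add"
  assumes add_left: "f (x + x') y = f x y + f x' y"
    and add_right: "f x (y + y') = f x y + f x y'"
begin

lemma zero_left: "f 0 y = 0"
  using add_left[of 0 0 y] by simp

lemma zero_right: "f x 0 = 0"
  using add_right[of x 0 0] by simp

lemma minus_left: "f (- x) y = - f x y"
  using add_left[of x "- x" y] by (simp add: zero_left add_eq_0_iff)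

lemma minus_right: "f x (- y) = - f x y"
  using add_right[of x y "- y"] by (simp add: zero_right add_eq_0_iff)

lemma diff_left: "f (x - x') y = f x y - f x' y"
  using add_left[of x "- x'" y] by (simp add: minus_left)

lemma diff_right: "f x (y - y') = f x y - f x y'"
  using add_right[of x y "- y'"] by (simp add: minus_right)

lemmas distrib = add_left add_right zero_left zero_right minus_left minus_right diff_left diff_right

end

lemma bilin_biadditive: "bilin s B \<Longrightarrow> biadditive B"
  unfolding bilin_def lin_def by unfold_locales simp_all

lemma bilin_scale:
  assumes "bilin s B"
  shows "B (s c x) y = s c (B x y)" "B x (s c y) = s c (B x y)"
  using assms unfolding bilin_def lin_def by simp_all

lemma triadditive_eq_0_from_homogeneous:
  fixes F :: "'a::ab_group_add \<times> 'b::ab_group_add \<Rightarrow> 'a \<times> 'b \<Rightarrow> 'a \<times> 'b \<Rightarrow> 'c::ab_group_add"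
  assumes add1: "\<And>u u' v w. F (u + u') v w = F u v w + F u' v w"
    and add2: "\<And>u v v' w. F u (v + v') w = F u v w + F u v' w"
    and add3: "\<And>u v w w'. F u v (w + w') = F u v w + F u v w'"
    and homogeneous: "\<And>u v w. fst u = 0 \<or> snd u = 0 \<Longrightarrow> fst v = 0 \<or> snd v = 0 \<Longrightarrow>
      fst w = 0 \<or> snd w = 0 \<Longrightarrow> F u v w = 0"
  shows "F u v w = 0"
proof -
  have split: "p = (fst p, 0) + (0, snd p)" for p :: "'a \<times> 'b" by simp
  have "F u v w = 0" if "fst v = 0 \<or> snd v = 0" "fst w = 0 \<or> snd w = 0" for u v w
    using add1[of "(fst u, 0)" "(0, snd u)" v w] homogeneous that by (simp flip: split)
  then have "F u v w = 0" if "fst w = 0 \<or> snd w = 0" for u v w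
    using add2[of u "(fst v, 0)" "(0, snd v)" w] that by (simp flip: split)
  then show ?thesis
    using add3[of u v "(fst w, 0)" "(0, snd w)"] by (simp flip: split)
qed

lemma homogeneous_cases:
  assumes "fst p = 0 \<or> snd p = 0"
  obtains x where "p = (x, 0)" | \<xi> where "p = (0, \<xi>)"
  using assms by (cases p) auto

section \<open>The pairing between \<open>A\<close> and \<open>A\<^sup>*\<close>\<close>

interpretation dpair: biadditive dpair
  by unfold_locales (simp_all add: dpair_def distrib_left distrib_right sum.distrib)

lemma dpair_commute: "dpair u v = dpair v u"
  unfolding dpair_def by (simp add: mult.commute)

lemma dpair_scale_left: "dpair (c *s u) v = c * dpair u v"
  unfolding dpair_def by (simp add: sum_distrib_left mult.assoc)

lemma dpair_scale_right: "dpair u (c *s v) = c * dpair u v"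
  unfolding dpair_def by (simp add: sum_distrib_left algebra_simps)

lemma dpair_axis: "dpair (u :: 'k::comm_ring_1 ^ 'n::finite) (axis i 1) = u $ i"
  unfolding dpair_def axis_def by (simp add: if_distrib cong: if_cong)

lemma dpair_eqI:
  fixes a b :: "'k::comm_ring_1 ^ 'n::finite"
  shows "(\<And>v. dpair a v = dpair b v) \<Longrightarrow> a = b"
  unfolding vec_eq_iff by (metis dpair_axis)

lemma linear_functional_eq_dpair:
  fixes g :: "'k::comm_ring_1 ^ 'n::finite \<Rightarrow> 'k"
  assumes "additive g" and "\<And>c v. g (c *s v) = c * g v"
  shows "g v = dpair (\<chi> j. g (axis j 1)) v"
proof -
  have "g v = g (\<Sum>j\<in>UNIV. v $ j *s axis j 1)"
    by (simp add: basis_expansion)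
  also have "\<dots> = (\<Sum>j\<in>UNIV. v $ j * g (axis j 1))"
    by (simp add: additive.sum[OF assms(1)] assms(2))
  also have "\<dots> = dpair (\<chi> j. g (axis j 1)) v"
    by (simp add: dpair_def mult.commute)
  finally show ?thesis .
qed

lemma dual_rep_pairing:
  fixes \<theta> :: "'a \<Rightarrow> 'k::field ^ 'n::finite \<Rightarrow> 'k ^ 'n"
  assumes "lin (*s) (*s) (\<theta> x)"
  shows "dpair (dual_rep \<theta> x \<xi>) v = - dpair \<xi> (\<theta> x v)"
proof -
  define g where "g v = - dpair \<xi> (\<theta> x v)" for v
  have "additive g" and "g (c *s v) = c * g v" for c v
    using assms by (simp_all add: additive_def g_def lin_def dpair.distrib dpair_scale_right)
  then have represents: "dpair (\<chi> j. g (axis j 1)) v = - dpair \<xi> (\<theta> x v)" for v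
    by (metis linear_functional_eq_dpair g_def)
  have "dual_rep \<theta> x \<xi> = (\<chi> j. g (axis j 1))"
    unfolding dual_rep_def
    by (rule the_equality) (use represents in \<open>auto intro: dpair_eqI\<close>)
  then show ?thesis
    using represents by simp
qed

lemma dual_rep_bilinear:
  fixes \<theta> :: "'k::field ^ 'n::finite \<Rightarrow> 'k ^ 'n \<Rightarrow> 'k ^ 'n"
  assumes "bilin (*s) \<theta>"
  shows "biadditive (dual_rep \<theta>)"
    and "dual_rep \<theta> (c *s x) \<xi> = c *s dual_rep \<theta> x \<xi>"
    and "dual_rep \<theta> x (c *s \<xi>) = c *s dual_rep \<theta> x \<xi>"
proof -
  have pairing: "dpair (dual_rep \<theta> x \<xi>) v = - dpair \<xi> (\<theta> x v)" for x \<xi> v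
    using assms unfolding bilin_def by (blast intro: dual_rep_pairing)
  interpret \<theta>: biadditive \<theta>
    using assms by (rule bilin_biadditive)
  show "biadditive (dual_rep \<theta>)"
    by unfold_locales (rule dpair_eqI; simp add: pairing dpair.distrib \<theta>.distrib)+
  show "dual_rep \<theta> (c *s x) \<xi> = c *s dual_rep \<theta> x \<xi>" "dual_rep \<theta> x (c *s \<xi>) = c *s dual_rep \<theta> x \<xi>"
    by (rule dpair_eqI; simp add: pairing bilin_scale[OF assms] dpair_scale_left dpair_scale_right)+
qed

section \<open>Malcev-Poisson algebras\<close>

lemma malcev_poissonD:
  assumes "malcev_poisson s br m"
  shows "bilin s br" "bilin s m" "malcev br" "m x y = m y x" "m (m x y) z = m x (m y z)"
    "br x (m y z) = m (br x y) z + m y (br x z)"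
  using assms unfolding malcev_poisson_def comm_assoc_def by blast+

lemma malcev_antisym: "malcev br \<Longrightarrow> br x y = - br y x"
  unfolding malcev_def by blast

lemma malcev_linearized:
  assumes "biadditive br" and "malcev br"
  shows "jac br x y (br w z) + jac br w y (br x z) = br (jac br x y z) w + br (jac br w y z) x"
proof -
  interpret biadditive br by fact
  have malcev: "jac br x y (br x z) = br (jac br x y z) x" for x y z
    using assms(2) unfolding malcev_def by blast
  have jac_add: "jac br (a + b) y z = jac br a y z + jac br b y z"
    "jac br y z (a + b) = jac br y z a + jac br y z b" for a b y z
    by (simp_all add: jac_def add_left add_right algebra_simps)
  have "jac br (x + w) y (br (x + w) z) = br (jac br (x + w) y z) (x + w)"
    by (rule malcev)
  then have "jac br x y (br x z) + jac br x y (br w z) + (jac br w y (br x z) + jac br w y (br w z))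
     = br (jac br x y z) x + br (jac br x y z) w + (br (jac br w y z) x + br (jac br w y z) w)"
    by (simp add: jac_add add_left add_right algebra_simps)
  then show ?thesis
    using malcev[of x y z] malcev[of w y z] by (simp add: algebra_simps)
qed

lemma malcev_adjoint_identity:
  fixes br :: "'a::ab_group_add \<Rightarrow> 'a \<Rightarrow> 'a"
  assumes "biadditive br" and "malcev br"
    and no_2_torsion: "\<And>u::'a. u + u = 0 \<Longrightarrow> u = 0"
  shows "br (br (br x y) z) v =
    br z (br y (br x v)) - br y (br x (br z v)) + br x (br (br y z) v) + br (br x z) (br y v)"
proof -
  interpret biadditive br by fact
  have anti: "\<And>a b. br a b = - br b a"
    using assms(2) by (rule malcev_antisym)
  have gr: "br v x = - (br x v)"
    "br v y = - (br y v)"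
    "br v z = - (br z v)"
    "br y x = - (br x y)"
    "br z x = - (br x z)"
    "br z y = - (br y z)"
    "br (br x v) y = - (br y (br x v))"
    "br (br x v) z = - (br z (br x v))"
    "br (br x y) v = - (br v (br x y))"
    "br (br x y) z = - (br z (br x y))"
    "br (br x z) v = - (br v (br x z))"
    "br (br x z) y = - (br y (br x z))"
    "br (br y v) x = - (br x (br y v))"
    "br (br y v) z = - (br z (br y v))"
    "br (br y z) v = - (br v (br y z))"
    "br (br y z) x = - (br x (br y z))"
    "br (br z v) x = - (br x (br z v))"
    "br (br z v) y = - (br y (br z v))"
    "br (br v (br x y)) z = - (br z (br v (br x y)))"
    "br (br v (br x z)) y = - (br y (br v (br x z)))"
    "br (br v (br y z)) x = - (br x (br v (br y z)))"
    "br (br x (br y v)) z = - (br z (br x (br y v)))"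
    "br (br x (br y z)) v = - (br v (br x (br y z)))"
    "br (br x (br z v)) y = - (br y (br x (br z v)))"
    "br (br y v) (br x z) = - (br (br x z) (br y v))"
    "br (br y z) (br x v) = - (br (br x v) (br y z))"
    "br (br y (br x v)) z = - (br z (br y (br x v)))"
    "br (br y (br x z)) v = - (br v (br y (br x z)))"
    "br (br y (br z v)) x = - (br x (br y (br z v)))"
    "br (br z v) (br x y) = - (br (br x y) (br z v))"
    "br (br z (br x v)) y = - (br y (br z (br x v)))"
    "br (br z (br x y)) v = - (br v (br z (br x y)))"
    "br (br z (br y v)) x = - (br x (br z (br y v)))"
    by (simp_all only: anti[symmetric])
  \<comment> \<open>Twice the defect of the representation identity is an alternating sum of three
    instances of the linearized Malcev identity.\<close>
  define d where "d = br (br (br x y) z) v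
    - (br z (br y (br x v)) - br y (br x (br z v)) + br x (br (br y z) v) + br (br x z) (br y v))"
  have "d + d = - ((jac br x z (br y v) + jac br y z (br x v) - (br (jac br x z v) y + br (jac br y z v) x))
     - (jac br x v (br z y) + jac br z v (br x y) - (br (jac br x v y) z + br (jac br z v y) x))
     + (jac br x y (br v z) + jac br v y (br x z) - (br (jac br x y z) v + br (jac br v y z) x)))"
    unfolding d_def jac_def
    by (simp only: add_left add_right minus_left minus_right diff_conv_add_uminus minus_add_distrib
        minus_minus gr) (simp add: algebra_simps)
  then have "d + d = 0"
    using malcev_linearized[OF assms(1,2), of x z y v] malcev_linearized[OF assms(1,2), of x v z y]
      malcev_linearized[OF assms(1,2), of x y v z] by simp
  then have "d = 0"
    by (rule no_2_torsion)
  then show ?thesis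
    unfolding d_def by simp
qed

lemma vec_add_self_eq_0:
  fixes a :: "'k::field_char_0 ^ 'n"
  shows "a + a = 0 \<Longrightarrow> a = 0"
  by (simp add: vec_eq_iff flip: mult_2)

lemma pair_add_self_eq_0:
  fixes u :: "('k::field_char_0 ^ 'n) \<times> ('k ^ 'm)"
  shows "u + u = 0 \<Longrightarrow> u = 0"
  by (cases u) (simp add: zero_prod_def vec_add_self_eq_0)

section \<open>The form \<open>\<omega>\<^sub>d\<close> on \<open>A \<oplus> A\<^sup>*\<close>\<close>

interpretation omega_d: biadditive omega_d
  by unfold_locales (simp_all add: omega_d_def dpair.distrib)

lemma omega_d_commute: "omega_d u w = omega_d w u"
  unfolding omega_d_def by (simp add: dpair_commute)

lemma omega_d_eqI:
  fixes p q :: "('k::comm_ring_1 ^ 'n::finite) \<times> ('k ^ 'n)"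
  assumes "\<And>w. omega_d p w = omega_d q w"
  shows "p = q"
proof (rule prod_eqI)
  show "fst p = fst q"
    using assms[of "(0, _)"] by (intro dpair_eqI) (simp add: omega_d_def dpair.distrib)
  show "snd p = snd q"
    using assms[of "(_, 0)"] by (intro dpair_eqI) (simp add: omega_d_def dpair.distrib)
qed

lemma invariant_biadditive_unique:
  fixes B B' :: "('k::comm_ring_1 ^ 'n::finite) \<times> ('k ^ 'n) \<Rightarrow> ('k ^ 'n) \<times> ('k ^ 'n) \<Rightarrow> ('k ^ 'n) \<times> ('k ^ 'n)"
  assumes "biadditive B" and "biadditive B'"
    and invariant: "\<And>u v w. omega_d (B u v) w = omega_d u (B v w)"
    and invariant': "\<And>u v w. omega_d (B' u v) w = omega_d u (B' v w)"
    and "\<And>x y. B (x, 0) (y, 0) = B' (x, 0) (y, 0)"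
    and "\<And>\<xi> \<eta>. B (0, \<xi>) (0, \<eta>) = B' (0, \<xi>) (0, \<eta>)"
  shows "B = B'"
proof -
  interpret B: biadditive B by fact
  interpret B': biadditive B' by fact
  define F where "F u v w = omega_d (B u v) w - omega_d (B' u v) w" for u v w
  \<comment> \<open>Invariance and symmetry of \<open>\<omega>\<^sub>d\<close> make \<open>F\<close> cyclic, so among three homogeneous
    arguments the two of the same kind can always be moved into \<open>B\<close>, where \<open>B\<close> and \<open>B'\<close> agree.\<close>
  have cyclic: "F u v w = F v w u" for u v w
    unfolding F_def by (metis invariant invariant' omega_d_commute)
  have "B u v = B' u v" if "snd u = 0 \<and> snd v = 0 \<or> fst u = 0 \<and> fst v = 0" for u v
    using that assms(5,6) by (cases u; cases v) auto
  then have same_kind: "F u v w = 0" if "snd u = 0 \<and> snd v = 0 \<or> fst u = 0 \<and> fst v = 0" for u v w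
    using that by (simp add: F_def)
  have "F u v w = 0" for u v w
  proof (rule triadditive_eq_0_from_homogeneous)
    show "F (u + u') v w = F u v w + F u' v w" "F u (v + v') w = F u v w + F u v' w"
      "F u v (w + w') = F u v w + F u v w'" for u u' v v' w w'
      unfolding F_def by (simp_all add: B.distrib B'.distrib omega_d.distrib)
    show "F u v w = 0" if "fst u = 0 \<or> snd u = 0" "fst v = 0 \<or> snd v = 0" "fst w = 0 \<or> snd w = 0"
      for u v w
      using that same_kind[of u v w] same_kind[of v w u] same_kind[of w u v] cyclic[of u v w]
        cyclic[of v w u] by auto
  qed
  then show ?thesis
    by (intro ext omega_d_eqI) (simp add: F_def)
qed

section \<open>The double of two Malcev-Poisson structures on \<open>A\<close> and \<open>A\<^sup>*\<close>\<close>

locale dual_malcev_poisson =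
  fixes br1 m1 br2 m2 :: "'k::field_char_0 ^ 'n::finite \<Rightarrow> 'k ^ 'n \<Rightarrow> 'k ^ 'n"
  assumes mp1: "malcev_poisson (*s) br1 m1" and mp2: "malcev_poisson (*s) br2 m2"
begin

lemmas br1_bilin = malcev_poissonD(1)[OF mp1]
  and m1_bilin = malcev_poissonD(2)[OF mp1]
  and br2_bilin = malcev_poissonD(1)[OF mp2]
  and m2_bilin = malcev_poissonD(2)[OF mp2]

sublocale br1: biadditive br1 using br1_bilin by (rule bilin_biadditive)
sublocale m1: biadditive m1 using m1_bilin by (rule bilin_biadditive)
sublocale br2: biadditive br2 using br2_bilin by (rule bilin_biadditive)
sublocale m2: biadditive m2 using m2_bilin by (rule bilin_biadditive)

lemma br1_antisym: "br1 x y = - br1 y x"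
  using malcev_poissonD(3)[OF mp1] by (rule malcev_antisym)

lemma br2_antisym: "br2 \<xi> \<eta> = - br2 \<eta> \<xi>"
  using malcev_poissonD(3)[OF mp2] by (rule malcev_antisym)

lemmas m1_commute = malcev_poissonD(4)[OF mp1]
  and m2_commute = malcev_poissonD(4)[OF mp2]

definition rho1 :: "'k ^ 'n \<Rightarrow> 'k ^ 'n \<Rightarrow> 'k ^ 'n" where "rho1 = dual_rep br1"
definition mu1 :: "'k ^ 'n \<Rightarrow> 'k ^ 'n \<Rightarrow> 'k ^ 'n" where "mu1 x \<xi> = - dual_rep m1 x \<xi>"
definition rho2 :: "'k ^ 'n \<Rightarrow> 'k ^ 'n \<Rightarrow> 'k ^ 'n" where "rho2 = dual_rep br2"
definition mu2 :: "'k ^ 'n \<Rightarrow> 'k ^ 'n \<Rightarrow> 'k ^ 'n" where "mu2 \<xi> x = - dual_rep m2 \<xi> x"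

lemma rho1_pairing: "dpair (rho1 x \<xi>) y = - dpair \<xi> (br1 x y)"
  using br1_bilin unfolding rho1_def bilin_def by (simp add: dual_rep_pairing)

lemma mu1_pairing: "dpair (mu1 x \<xi>) y = dpair \<xi> (m1 x y)"
  using m1_bilin unfolding mu1_def bilin_def by (simp add: dual_rep_pairing dpair.minus_left)

lemma rho2_pairing: "dpair (rho2 \<xi> x) \<eta> = - dpair x (br2 \<xi> \<eta>)"
  using br2_bilin unfolding rho2_def bilin_def by (simp add: dual_rep_pairing)

lemma mu2_pairing: "dpair (mu2 \<xi> x) \<eta> = dpair x (m2 \<xi> \<eta>)"
  using m2_bilin unfolding mu2_def bilin_def by (simp add: dual_rep_pairing dpair.minus_left)

sublocale rho1: biadditive rho1
  unfolding rho1_def using br1_bilin by (rule dual_rep_bilinear)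

sublocale rho2: biadditive rho2
  unfolding rho2_def using br2_bilin by (rule dual_rep_bilinear)

sublocale mu1: biadditive mu1
proof -
  interpret biadditive "dual_rep m1" using m1_bilin by (rule dual_rep_bilinear)
  show "biadditive mu1" by unfold_locales (simp_all add: mu1_def add_left add_right)
qed

sublocale mu2: biadditive mu2
proof -
  interpret biadditive "dual_rep m2" using m2_bilin by (rule dual_rep_bilinear)
  show "biadditive mu2" by unfold_locales (simp_all add: mu2_def add_left add_right)
qed

lemmas bilinear_simps = br1.distrib m1.distrib br2.distrib m2.distrib
  rho1.distrib mu1.distrib rho2.distrib mu2.distrib

lemma mu_scale:
  "mu1 (c *s x) \<xi> = c *s mu1 x \<xi>" "mu1 x (c *s \<xi>) = c *s mu1 x \<xi>"
  "mu2 (c *s \<xi>) x = c *s mu2 \<xi> x" "mu2 \<xi> (c *s x) = c *s mu2 \<xi> x"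
  by (simp_all add: mu1_def mu2_def dual_rep_bilinear(2,3)[OF m1_bilin]
      dual_rep_bilinear(2,3)[OF m2_bilin] vector_smult_rneg)

lemmas scale = bilin_scale[OF br1_bilin] bilin_scale[OF m1_bilin]
  bilin_scale[OF br2_bilin] bilin_scale[OF m2_bilin]
  dual_rep_bilinear(2,3)[OF br1_bilin, folded rho1_def]
  dual_rep_bilinear(2,3)[OF br2_bilin, folded rho2_def] mu_scale

lemma rep_linear:
  "rep_linear (*s) (*s) rho1" "rep_linear (*s) (*s) mu1"
  "rep_linear (*s) (*s) rho2" "rep_linear (*s) (*s) mu2"
  unfolding rep_linear_def lin_def by (simp_all add: bilinear_simps scale)

definition dbr :: "('k ^ 'n) \<times> ('k ^ 'n) \<Rightarrow> ('k ^ 'n) \<times> ('k ^ 'n) \<Rightarrow> ('k ^ 'n) \<times> ('k ^ 'n)"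
  where "dbr = mp_bracket br1 br2 rho1 rho2"

definition dprod :: "('k ^ 'n) \<times> ('k ^ 'n) \<Rightarrow> ('k ^ 'n) \<times> ('k ^ 'n) \<Rightarrow> ('k ^ 'n) \<times> ('k ^ 'n)"
  where "dprod u v =
    (m1 (fst u) (fst v) + mu2 (snd u) (fst v) + mu2 (snd v) (fst u),
     m2 (snd u) (snd v) + mu1 (fst u) (snd v) + mu1 (fst v) (snd u))"

lemma dbr_eq:
  "dbr u v = (br1 (fst u) (fst v) + rho2 (snd u) (fst v) - rho2 (snd v) (fst u),
    br2 (snd u) (snd v) + rho1 (fst u) (snd v) - rho1 (fst v) (snd u))"
  by (cases u; cases v) (simp add: dbr_def)

lemma dbr_pair [simp]:
  "dbr (x, \<xi>) (y, \<eta>) = (br1 x y + rho2 \<xi> y - rho2 \<eta> x, br2 \<xi> \<eta> + rho1 x \<eta> - rho1 y \<xi>)"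
  by (simp add: dbr_eq)

lemma dprod_pair [simp]:
  "dprod (x, \<xi>) (y, \<eta>) = (m1 x y + mu2 \<xi> y + mu2 \<eta> x, m2 \<xi> \<eta> + mu1 x \<eta> + mu1 y \<xi>)"
  by (simp add: dprod_def)

sublocale dbr: biadditive dbr
proof
  show "dbr (u + u') v = dbr u v + dbr u' v" "dbr v (u + u') = dbr v u + dbr v u'" for u u' v
    by (simp_all add: dbr_eq bilinear_simps)
qed

sublocale dprod: biadditive dprod
proof
  show "dprod (u + u') v = dprod u v + dprod u' v" "dprod v (u + u') = dprod v u + dprod v u'" for u u' v
    by (simp_all add: dprod_def bilinear_simps)
qed

lemma bilin_dbr: "bilin dsc dbr"
  unfolding bilin_def lin_def
  by (simp add: dbr_eq dsc_def bilinear_simps scale vector_add_ldistrib vector_ssub_ldistrib)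

lemma bilin_dprod: "bilin dsc dprod"
  unfolding bilin_def lin_def
  by (simp add: dprod_def dsc_def bilinear_simps scale vector_add_ldistrib)

lemma dprod_commute: "dprod u v = dprod v u"
  by (simp add: dprod_def m1_commute m2_commute algebra_simps)

lemma dpair_rho_mu_right:
  "dpair y (rho1 x \<xi>) = - dpair \<xi> (br1 x y)" "dpair y (mu1 x \<xi>) = dpair \<xi> (m1 x y)"
  "dpair \<eta> (rho2 \<xi> x) = - dpair x (br2 \<xi> \<eta>)" "dpair \<eta> (mu2 \<xi> x) = dpair x (m2 \<xi> \<eta>)"
  by (simp_all add: dpair_commute[of _ "rho1 _ _"] dpair_commute[of _ "mu1 _ _"]
      dpair_commute[of _ "rho2 _ _"] dpair_commute[of _ "mu2 _ _"]
      rho1_pairing mu1_pairing rho2_pairing mu2_pairing)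

lemma omega_d_dbr: "omega_d (dbr u v) w = omega_d u (dbr v w)"
proof (cases u; cases v; cases w)
  fix x \<xi> y \<eta> z \<zeta>
  assume [simp]: "u = (x, \<xi>)" "v = (y, \<eta>)" "w = (z, \<zeta>)"
  show ?thesis
    using br1_antisym[of y x] br1_antisym[of z x] br2_antisym[of \<zeta> \<xi>] br2_antisym[of \<eta> \<xi>]
    by (simp add: omega_d_def dpair.distrib rho1_pairing rho2_pairing dpair_rho_mu_right
        dpair_commute[of "br1 _ _"] dpair_commute[of "br2 _ _"])
qed

lemma omega_d_dprod: "omega_d (dprod u v) w = omega_d u (dprod v w)"
proof (cases u; cases v; cases w)
  fix x \<xi> y \<eta> z \<zeta>
  assume [simp]: "u = (x, \<xi>)" "v = (y, \<eta>)" "w = (z, \<zeta>)"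
  show ?thesis
    using m1_commute[of y x] m1_commute[of z x] m2_commute[of \<zeta> \<xi>] m2_commute[of \<eta> \<xi>]
    by (simp add: omega_d_def dpair.distrib mu1_pairing mu2_pairing dpair_rho_mu_right
        dpair_commute[of "m1 _ _"] dpair_commute[of "m2 _ _"])
qed

lemma std_manin_triple_iff_double: "std_manin_triple br1 m1 br2 m2 \<longleftrightarrow> malcev_poisson dsc dbr dprod"
proof
  assume "std_manin_triple br1 m1 br2 m2"
  then obtain br m where mp: "malcev_poisson dsc br m"
    and br_restrict: "\<And>x y. br (x, 0) (y, 0) = (br1 x y, 0)" "\<And>\<xi> \<eta>. br (0, \<xi>) (0, \<eta>) = (0, br2 \<xi> \<eta>)"
    and m_restrict: "\<And>x y. m (x, 0) (y, 0) = (m1 x y, 0)" "\<And>\<xi> \<eta>. m (0, \<xi>) (0, \<eta>) = (0, m2 \<xi> \<eta>)"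
    and "\<And>u v w. omega_d (m u v) w = omega_d u (m v w)" "\<And>u v w. omega_d (br u v) w = omega_d u (br v w)"
    unfolding std_manin_triple_def by blast
  have "br = dbr"
    using bilin_biadditive[OF malcev_poissonD(1)[OF mp]] dbr.biadditive_axioms
      \<open>\<And>u v w. omega_d (br u v) w = omega_d u (br v w)\<close> omega_d_dbr
    by (rule invariant_biadditive_unique) (simp_all add: br_restrict bilinear_simps)
  moreover have "m = dprod"
    using bilin_biadditive[OF malcev_poissonD(2)[OF mp]] dprod.biadditive_axioms
      \<open>\<And>u v w. omega_d (m u v) w = omega_d u (m v w)\<close> omega_d_dprod
    by (rule invariant_biadditive_unique) (simp_all add: m_restrict bilinear_simps)
  ultimately show "malcev_poisson dsc dbr dprod"
    using mp by simp
next
  assume "malcev_poisson dsc dbr dprod"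
  then show "std_manin_triple br1 m1 br2 m2"
    unfolding std_manin_triple_def
    by (intro exI[of _ dbr] exI[of _ dprod]) (simp add: omega_d_dbr omega_d_dprod bilinear_simps)
qed

definition assoc_defect where
  "assoc_defect u v w = dprod (dprod u v) w - dprod u (dprod v w)"

definition leibniz_defect where
  "leibniz_defect u v w = dbr u (dprod v w) - (dprod (dbr u v) w + dprod v (dbr u w))"

lemma assoc_defect_additive:
  "assoc_defect (u + u') v w = assoc_defect u v w + assoc_defect u' v w"
  "assoc_defect u (v + v') w = assoc_defect u v w + assoc_defect u v' w"
  "assoc_defect u v (w + w') = assoc_defect u v w + assoc_defect u v w'"
  unfolding assoc_defect_def by (simp_all add: dprod.distrib)

lemma leibniz_defect_additive:
  "leibniz_defect (u + u') v w = leibniz_defect u v w + leibniz_defect u' v w"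
  "leibniz_defect u (v + v') w = leibniz_defect u v w + leibniz_defect u v' w"
  "leibniz_defect u v (w + w') = leibniz_defect u v w + leibniz_defect u v w'"
  unfolding leibniz_defect_def by (simp_all add: dprod.distrib dbr.distrib)

lemma assoc_defect_swap: "assoc_defect w v u = - assoc_defect u v w"
proof -
  have "dprod (dprod w v) u = dprod u (dprod v w)" "dprod w (dprod v u) = dprod (dprod u v) w"
    by (simp_all only: dprod_commute)
  then show ?thesis
    unfolding assoc_defect_def by simp
qed

lemma leibniz_defect_swap: "leibniz_defect u v w = leibniz_defect u w v"
  unfolding leibniz_defect_def by (simp add: dprod_commute)

definition comm_assoc_matched :: bool where
  "comm_assoc_matched \<longleftrightarrow>
    (\<forall>x y \<xi>. mu1 (m1 x y) \<xi> = mu1 x (mu1 y \<xi>)) \<and>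
    (\<forall>\<xi> \<eta> x. mu2 (m2 \<xi> \<eta>) x = mu2 \<xi> (mu2 \<eta> x)) \<and>
    (\<forall>x \<xi> \<eta>. mu1 x (m2 \<xi> \<eta>) = m2 (mu1 x \<xi>) \<eta> + mu1 (mu2 \<xi> x) \<eta>) \<and>
    (\<forall>\<xi> x y. mu2 \<xi> (m1 x y) = m1 (mu2 \<xi> x) y + mu2 (mu1 x \<xi>) y)"

lemma assoc_defect_eq_0_iff: "(\<forall>u v w. assoc_defect u v w = 0) \<longleftrightarrow> comm_assoc_matched"
proof
  assume "\<forall>u v w. assoc_defect u v w = 0"
  then have zero: "assoc_defect u v w = 0" for u v w
    by blast
  show comm_assoc_matched
    unfolding comm_assoc_matched_def
  proof (intro conjI allI)
    show "mu1 (m1 x y) \<xi> = mu1 x (mu1 y \<xi>)" for x y \<xi>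
      using zero[of "(x, 0)" "(y, 0)" "(0, \<xi>)"] by (simp add: assoc_defect_def bilinear_simps zero_prod_def)
    show "mu2 (m2 \<xi> \<eta>) x = mu2 \<xi> (mu2 \<eta> x)" for \<xi> \<eta> x
      using zero[of "(0, \<xi>)" "(0, \<eta>)" "(x, 0)"] by (simp add: assoc_defect_def bilinear_simps zero_prod_def)
    show "mu1 x (m2 \<xi> \<eta>) = m2 (mu1 x \<xi>) \<eta> + mu1 (mu2 \<xi> x) \<eta>" for x \<xi> \<eta>
      using zero[of "(x, 0)" "(0, \<xi>)" "(0, \<eta>)"]
      by (simp add: assoc_defect_def bilinear_simps zero_prod_def algebra_simps)
    show "mu2 \<xi> (m1 x y) = m1 (mu2 \<xi> x) y + mu2 (mu1 x \<xi>) y" for \<xi> x y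
      using zero[of "(0, \<xi>)" "(x, 0)" "(y, 0)"]
      by (simp add: assoc_defect_def bilinear_simps zero_prod_def algebra_simps)
  qed
next
  assume comm_assoc_matched
  then have mu1_m1: "mu1 (m1 x y) \<xi> = mu1 x (mu1 y \<xi>)"
    and mu2_m2: "mu2 (m2 \<xi> \<eta>) x = mu2 \<xi> (mu2 \<eta> x)"
    and mu1_m2: "mu1 x (m2 \<xi> \<eta>) = m2 (mu1 x \<xi>) \<eta> + mu1 (mu2 \<xi> x) \<eta>"
    and mu2_m1: "mu2 \<xi> (m1 x y) = m1 (mu2 \<xi> x) y + mu2 (mu1 x \<xi>) y" for x y \<xi> \<eta>
    unfolding comm_assoc_matched_def by (simp_all only:)
  note defect = assoc_defect_def bilinear_simps zero_prod_def algebra_simps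
  have A111: "assoc_defect (x, 0) (y, 0) (z, 0) = 0" for x y z
    by (simp add: defect malcev_poissonD(5)[OF mp1])
  have A222: "assoc_defect (0, \<xi>) (0, \<eta>) (0, \<zeta>) = 0" for \<xi> \<eta> \<zeta>
    by (simp add: defect malcev_poissonD(5)[OF mp2])
  have A112: "assoc_defect (x, 0) (y, 0) (0, \<zeta>) = 0" for x y \<zeta>
    using mu2_m1[of \<zeta> y x] mu1_m1[of x y \<zeta>] m1_commute[of y x] m1_commute[of "mu2 \<zeta> y" x]
    by (simp add: defect)
  have A121: "assoc_defect (x, 0) (0, \<eta>) (z, 0) = 0" for x \<eta> z
    using mu2_m1[of \<eta> x z] mu2_m1[of \<eta> z x] m1_commute[of z x] m1_commute[of "mu2 \<eta> z" x]
      mu1_m1[of x z \<eta>] mu1_m1[of z x \<eta>]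
    by (simp add: defect)
  have A122: "assoc_defect (x, 0) (0, \<eta>) (0, \<zeta>) = 0" for x \<eta> \<zeta>
    using mu2_m2[of \<zeta> \<eta> x] m2_commute[of \<zeta> \<eta>] mu1_m2[of x \<eta> \<zeta>]
    by (simp add: defect)
  have A212: "assoc_defect (0, \<xi>) (y, 0) (0, \<zeta>) = 0" for \<xi> y \<zeta>
    using mu2_m2[of \<zeta> \<xi> y] mu2_m2[of \<xi> \<zeta> y] m2_commute[of \<zeta> \<xi>] mu1_m2[of y \<xi> \<zeta>]
      mu1_m2[of y \<zeta> \<xi>] m2_commute[of "mu1 y \<zeta>" \<xi>]
    by (simp add: defect)
  have A211: "assoc_defect (0, \<xi>) (y, 0) (z, 0) = 0" for \<xi> y z
    using assoc_defect_swap[of "(0, \<xi>)" "(y, 0)" "(z, 0)"] A112[of z y \<xi>] by simp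
  have A221: "assoc_defect (0, \<xi>) (0, \<eta>) (z, 0) = 0" for \<xi> \<eta> z
    using assoc_defect_swap[of "(0, \<xi>)" "(0, \<eta>)" "(z, 0)"] A122[of z \<eta> \<xi>] by simp
  show "\<forall>u v w. assoc_defect u v w = 0"
  proof (intro allI, rule triadditive_eq_0_from_homogeneous[OF assoc_defect_additive])
    fix u v w :: "('k ^ 'n) \<times> ('k ^ 'n)"
    assume "fst u = 0 \<or> snd u = 0" "fst v = 0 \<or> snd v = 0" "fst w = 0 \<or> snd w = 0"
    then show "assoc_defect u v w = 0"
      by (elim homogeneous_cases)
        (simp_all add: A111 A222 A112 A121 A122 A212 A211 A221)
  qed
qed

definition leibniz_matched :: bool where
  "leibniz_matched \<longleftrightarrow>
    (\<forall>x y \<xi>. rho1 (m1 x y) \<xi> = mu1 y (rho1 x \<xi>) + mu1 x (rho1 y \<xi>)) \<and>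
    (\<forall>x y \<xi>. mu1 (br1 x y) \<xi> = rho1 x (mu1 y \<xi>) - mu1 y (rho1 x \<xi>)) \<and>
    (\<forall>\<xi> \<eta> x. rho2 (m2 \<xi> \<eta>) x = mu2 \<eta> (rho2 \<xi> x) + mu2 \<xi> (rho2 \<eta> x)) \<and>
    (\<forall>\<xi> \<eta> x. mu2 (br2 \<xi> \<eta>) x = rho2 \<xi> (mu2 \<eta> x) - mu2 \<eta> (rho2 \<xi> x)) \<and>
    (\<forall>x y \<xi>. rho2 \<xi> (m1 x y) =
      m1 (rho2 \<xi> x) y + m1 x (rho2 \<xi> y) - mu2 (rho1 x \<xi>) y - mu2 (rho1 y \<xi>) x) \<and>
    (\<forall>\<xi> \<eta> x. rho1 x (m2 \<xi> \<eta>) =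
      m2 (rho1 x \<xi>) \<eta> + m2 \<xi> (rho1 x \<eta>) - mu1 (rho2 \<xi> x) \<eta> - mu1 (rho2 \<eta> x) \<xi>) \<and>
    (\<forall>x y \<xi>. br1 x (mu2 \<xi> y) - rho2 (mu1 y \<xi>) x =
      mu2 (rho1 x \<xi>) y - m1 (rho2 \<xi> x) y + mu2 \<xi> (br1 x y)) \<and>
    (\<forall>\<xi> \<eta> x. br2 \<xi> (mu1 x \<eta>) - rho1 (mu2 \<eta> x) \<xi> =
      mu1 (rho2 \<xi> x) \<eta> - m2 (rho1 x \<xi>) \<eta> + mu1 x (br2 \<xi> \<eta>))"

lemma leibniz_defect_eq_0_iff: "(\<forall>u v w. leibniz_defect u v w = 0) \<longleftrightarrow> leibniz_matched"
proof
  assume "\<forall>u v w. leibniz_defect u v w = 0"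
  then have zero: "leibniz_defect u v w = 0" for u v w
    by blast
  note defect = leibniz_defect_def bilinear_simps zero_prod_def algebra_simps
  show leibniz_matched
    unfolding leibniz_matched_def
  proof (intro conjI allI)
    show "rho1 (m1 x y) \<xi> = mu1 y (rho1 x \<xi>) + mu1 x (rho1 y \<xi>)" for x y \<xi>
      using zero[of "(0, \<xi>)" "(x, 0)" "(y, 0)"] by (simp add: defect)
    show "mu1 (br1 x y) \<xi> = rho1 x (mu1 y \<xi>) - mu1 y (rho1 x \<xi>)" for x y \<xi>
      using zero[of "(x, 0)" "(y, 0)" "(0, \<xi>)"] by (simp add: defect)
    show "rho2 (m2 \<xi> \<eta>) x = mu2 \<eta> (rho2 \<xi> x) + mu2 \<xi> (rho2 \<eta> x)" for \<xi> \<eta> x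
      using zero[of "(x, 0)" "(0, \<xi>)" "(0, \<eta>)"] by (simp add: defect)
    show "mu2 (br2 \<xi> \<eta>) x = rho2 \<xi> (mu2 \<eta> x) - mu2 \<eta> (rho2 \<xi> x)" for \<xi> \<eta> x
      using zero[of "(0, \<xi>)" "(0, \<eta>)" "(x, 0)"] by (simp add: defect)
    show "rho2 \<xi> (m1 x y) =
      m1 (rho2 \<xi> x) y + m1 x (rho2 \<xi> y) - mu2 (rho1 x \<xi>) y - mu2 (rho1 y \<xi>) x" for \<xi> x y
      using zero[of "(0, \<xi>)" "(x, 0)" "(y, 0)"] by (simp add: defect)
    show "rho1 x (m2 \<xi> \<eta>) =
      m2 (rho1 x \<xi>) \<eta> + m2 \<xi> (rho1 x \<eta>) - mu1 (rho2 \<xi> x) \<eta> - mu1 (rho2 \<eta> x) \<xi>" for x \<xi> \<eta>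
      using zero[of "(x, 0)" "(0, \<xi>)" "(0, \<eta>)"] by (simp add: defect)
    show "br1 x (mu2 \<xi> y) - rho2 (mu1 y \<xi>) x =
      mu2 (rho1 x \<xi>) y - m1 (rho2 \<xi> x) y + mu2 \<xi> (br1 x y)" for x \<xi> y
      using zero[of "(x, 0)" "(y, 0)" "(0, \<xi>)"] m1_commute[of y "rho2 \<xi> x"] by (simp add: defect)
    show "br2 \<xi> (mu1 x \<eta>) - rho1 (mu2 \<eta> x) \<xi> =
      mu1 (rho2 \<xi> x) \<eta> - m2 (rho1 x \<xi>) \<eta> + mu1 x (br2 \<xi> \<eta>)" for \<xi> x \<eta>
      using zero[of "(0, \<xi>)" "(x, 0)" "(0, \<eta>)"] by (simp add: defect)
  qed
next
  assume leibniz_matched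
  then have rho1_m1: "rho1 (m1 x y) \<xi> = mu1 y (rho1 x \<xi>) + mu1 x (rho1 y \<xi>)"
    and mu1_br1: "mu1 (br1 x y) \<xi> = rho1 x (mu1 y \<xi>) - mu1 y (rho1 x \<xi>)"
    and rho2_m2: "rho2 (m2 \<xi> \<eta>) x = mu2 \<eta> (rho2 \<xi> x) + mu2 \<xi> (rho2 \<eta> x)"
    and mu2_br2: "mu2 (br2 \<xi> \<eta>) x = rho2 \<xi> (mu2 \<eta> x) - mu2 \<eta> (rho2 \<xi> x)"
    and rho2_m1: "rho2 \<xi> (m1 x y) =
      m1 (rho2 \<xi> x) y + m1 x (rho2 \<xi> y) - mu2 (rho1 x \<xi>) y - mu2 (rho1 y \<xi>) x"
    and rho1_m2: "rho1 x (m2 \<xi> \<eta>) =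
      m2 (rho1 x \<xi>) \<eta> + m2 \<xi> (rho1 x \<eta>) - mu1 (rho2 \<xi> x) \<eta> - mu1 (rho2 \<eta> x) \<xi>"
    and br1_mu2: "br1 x (mu2 \<xi> y) - rho2 (mu1 y \<xi>) x =
      mu2 (rho1 x \<xi>) y - m1 (rho2 \<xi> x) y + mu2 \<xi> (br1 x y)"
    and br2_mu1: "br2 \<xi> (mu1 x \<eta>) - rho1 (mu2 \<eta> x) \<xi> =
      mu1 (rho2 \<xi> x) \<eta> - m2 (rho1 x \<xi>) \<eta> + mu1 x (br2 \<xi> \<eta>)"
    for x y \<xi> \<eta>
    unfolding leibniz_matched_def by (simp_all only:)
  note defect = leibniz_defect_def bilinear_simps zero_prod_def algebra_simps
  have L111: "leibniz_defect (x, 0) (y, 0) (z, 0) = 0" for x y z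
    by (simp add: defect malcev_poissonD(6)[OF mp1])
  have L222: "leibniz_defect (0, \<xi>) (0, \<eta>) (0, \<zeta>) = 0" for \<xi> \<eta> \<zeta>
    by (simp add: defect malcev_poissonD(6)[OF mp2])
  have L112: "leibniz_defect (x, 0) (y, 0) (0, \<zeta>) = 0" for x y \<zeta>
    using br1_mu2[of x \<zeta> y] mu1_br1[of x y \<zeta>] m1_commute[of y "rho2 \<zeta> x"] by (simp add: defect)
  have L122: "leibniz_defect (x, 0) (0, \<eta>) (0, \<zeta>) = 0" for x \<eta> \<zeta>
    using rho2_m2[of \<eta> \<zeta> x] rho1_m2[of x \<eta> \<zeta>] by (simp add: defect)
  have L211: "leibniz_defect (0, \<xi>) (y, 0) (z, 0) = 0" for \<xi> y z
    using rho2_m1[of \<xi> y z] rho1_m1[of y z \<xi>] by (simp add: defect)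
  have L212: "leibniz_defect (0, \<xi>) (y, 0) (0, \<zeta>) = 0" for \<xi> y \<zeta>
    using mu2_br2[of \<xi> \<zeta> y] br2_mu1[of \<xi> y \<zeta>] by (simp add: defect)
  have L121: "leibniz_defect (x, 0) (0, \<eta>) (z, 0) = 0" for x \<eta> z
    using L112[of x z \<eta>] by (simp add: leibniz_defect_swap[of _ "(0, \<eta>)"])
  have L221: "leibniz_defect (0, \<xi>) (0, \<eta>) (z, 0) = 0" for \<xi> \<eta> z
    using L212[of \<xi> z \<eta>] by (simp add: leibniz_defect_swap[of _ "(0, \<eta>)"])
  show "\<forall>u v w. leibniz_defect u v w = 0"
  proof (intro allI, rule triadditive_eq_0_from_homogeneous[OF leibniz_defect_additive])
    fix u v w :: "('k ^ 'n) \<times> ('k ^ 'n)"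
    assume "fst u = 0 \<or> snd u = 0" "fst v = 0 \<or> snd v = 0" "fst w = 0 \<or> snd w = 0"
    then show "leibniz_defect u v w = 0"
      by (elim homogeneous_cases)
        (simp_all add: L111 L222 L112 L122 L211 L212 L121 L221)
  qed
qed

lemma malcev_poisson_double_iff:
  "malcev_poisson dsc dbr dprod \<longleftrightarrow> malcev dbr \<and> comm_assoc_matched \<and> leibniz_matched"
  unfolding malcev_poisson_def comm_assoc_def
    assoc_defect_eq_0_iff[symmetric] leibniz_defect_eq_0_iff[symmetric] assoc_defect_def leibniz_defect_def
  by (simp add: bilin_dbr bilin_dprod dprod_commute)

lemma malcev_rep_rho1:
  assumes "malcev dbr"
  shows "malcev_rep (*s) (*s) br1 rho1"
  unfolding malcev_rep_def
proof (intro conjI allI rep_linear)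
  fix x y z \<xi>
  have "snd (dbr (dbr (dbr (x, 0) (y, 0)) (z, 0)) (0, \<xi>)) =
    snd (dbr (z, 0) (dbr (y, 0) (dbr (x, 0) (0, \<xi>))) - dbr (y, 0) (dbr (x, 0) (dbr (z, 0) (0, \<xi>)))
      + dbr (x, 0) (dbr (dbr (y, 0) (z, 0)) (0, \<xi>)) + dbr (dbr (x, 0) (z, 0)) (dbr (y, 0) (0, \<xi>)))"
    by (simp only: malcev_adjoint_identity[OF dbr.biadditive_axioms assms pair_add_self_eq_0])
  then show "rho1 (br1 (br1 x y) z) \<xi> =
    rho1 z (rho1 y (rho1 x \<xi>)) - rho1 y (rho1 x (rho1 z \<xi>)) + rho1 x (rho1 (br1 y z) \<xi>)
      + rho1 (br1 x z) (rho1 y \<xi>)"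
    by (simp add: bilinear_simps)
qed

lemma malcev_rep_rho2:
  assumes "malcev dbr"
  shows "malcev_rep (*s) (*s) br2 rho2"
  unfolding malcev_rep_def
proof (intro conjI allI rep_linear)
  fix \<xi> \<eta> \<zeta> x
  have "fst (dbr (dbr (dbr (0, \<xi>) (0, \<eta>)) (0, \<zeta>)) (x, 0)) =
    fst (dbr (0, \<zeta>) (dbr (0, \<eta>) (dbr (0, \<xi>) (x, 0))) - dbr (0, \<eta>) (dbr (0, \<xi>) (dbr (0, \<zeta>) (x, 0)))
      + dbr (0, \<xi>) (dbr (dbr (0, \<eta>) (0, \<zeta>)) (x, 0)) + dbr (dbr (0, \<xi>) (0, \<zeta>)) (dbr (0, \<eta>) (x, 0)))"
    by (simp only: malcev_adjoint_identity[OF dbr.biadditive_axioms assms pair_add_self_eq_0])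
  then show "rho2 (br2 (br2 \<xi> \<eta>) \<zeta>) x =
    rho2 \<zeta> (rho2 \<eta> (rho2 \<xi> x)) - rho2 \<eta> (rho2 \<xi> (rho2 \<zeta> x)) + rho2 \<xi> (rho2 (br2 \<eta> \<zeta>) x)
      + rho2 (br2 \<xi> \<zeta>) (rho2 \<eta> x)"
    by (simp add: bilinear_simps)
qed

lemma matched_pair_iff:
  "matched_pair (*s) (*s) br1 m1 br2 m2 rho1 mu1 rho2 mu2 \<longleftrightarrow>
    malcev dbr \<and> comm_assoc_matched \<and> leibniz_matched"
  using malcev_rep_rho1 malcev_rep_rho2 rep_linear
  unfolding matched_pair_def mp_rep_def assoc_rep_def comm_assoc_matched_def leibniz_matched_def dbr_def
  by argo

end

theorem mainTheorem2:
  fixes br1 m1 br2 m2 :: "'k::field_char_0 ^ 'n::finite \<Rightarrow> 'k ^ 'n \<Rightarrow> 'k ^ 'n"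
  assumes "alg_closed_field TYPE('k)"
    and "malcev_poisson (*s) br1 m1"
    and "malcev_poisson (*s) br2 m2"
  shows "std_manin_triple br1 m1 br2 m2 \<longleftrightarrow>
    matched_pair (*s) (*s) br1 m1 br2 m2
      (dual_rep br1) (\<lambda>x \<xi>. - dual_rep m1 x \<xi>)
      (dual_rep br2) (\<lambda>\<xi> x. - dual_rep m2 \<xi> x)"
proof -
  interpret dual_malcev_poisson br1 m1 br2 m2
    using assms(2,3) by unfold_locales
  have "std_manin_triple br1 m1 br2 m2 \<longleftrightarrow> malcev_poisson dsc dbr dprod"
    by (rule std_manin_triple_iff_double)
  also have "\<dots> \<longleftrightarrow> matched_pair (*s) (*s) br1 m1 br2 m2 rho1 mu1 rho2 mu2"
    by (simp add: malcev_poisson_double_iff matched_pair_iff)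
  finally show ?thesis
    by (simp add: rho1_def rho2_def mu1_def[abs_def] mu2_def[abs_def])
qed

end
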